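(* Let $A,B,C$ be $\ast$-algebras with involutions $j_A,j_B,j_C$ respectively, and let $R_1:B\otimes A\to A\otimes B$, $R_2:C\otimes B\to B\otimes C$, $R_3:C\otimes A\to A\otimes C$ be compatible twisting maps, i.e. twisting maps with $$(A\otimes R_2)\circ(R_3\otimes B)\circ(C\otimes R_1)=(R_1\otimes C)\circ(B\otimes R_3)\circ(R_2\otimes A),$$ such that $$(R_1\circ(j_B\otimes j_A)\circ\tau_{AB})\circ(R_1\circ(j_B\otimes j_A)\circ\tau_{AB})=\mathrm{id}_{A\otimes B},$$ $$(R_2\circ(j_C\otimes j_B)\circ\tau_{BC})\circ(R_2\circ(j_C\otimes j_B)\circ\tau_{BC})=\mathrm{id}_{B\otimes C},$$ $$(R_3\circ(j_C\otimes j_A)\circ\tau_{AC})\circ(R_3\circ(j_C\otimes j_A)\circ\tau_{AC})=\mathrm{id}_{A\otimes C}.$$ Then $A\otimes_{R_1}B\otimes_{R_2}C$ is a $\ast$-algebra with involution $$j=(R_1\otimes C)\circ(B\otimes R_3)\circ(R_2\otimes A)\circ(j_C\otimes j_B\otimes j_A)\circ(C\otimes\tau_{AB})\circ(\tau_{AC}\otimes B)\circ(A\otimes\tau_{BC}),$$ where $\tau_{AB}:A\otimes B\to B\otimes A$, $\tau_{BC}:B\otimes C\to C\otimes B$ and $\tau_{AC}:A\otimes C\to C\otimes A$ denote the usual flips.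
   Context: Algebras are associative unital algebras over $\mathbb C$; $\otimes=\otimes_{\mathbb C}$; $\mu_A$ is the product of $A$; an object also denotes its identity map. A $\ast$-algebra is an algebra with an antilinear, antimultiplicative map $j_A$ with $j_A^2=\mathrm{id}$. A twisting map for algebras $A,B$ is a linear map $R:B\otimes A\to A\otimes B$ with $$R\circ(B\otimes\mu_A)=(\mu_A\otimes B)\circ(A\otimes R)\circ(R\otimes A),\qquad R\circ(\mu_B\otimes A)=(A\otimes\mu_B)\circ(R\otimes B)\circ(B\otimes R).$$ $A\otimes_R B$ denotes $A\otimes B$ with the associative product $(\mu_A\otimes\mu_B)\circ(A\otimes R\otimes B)$. For compatible twisting maps, $A\otimes_{R_1}B\otimes_{R_2}C$ denotes the associative algebra $(A\otimes_{R_1}B)\otimes_{T_1}C$ with $T_1:=(A\otimes R_2)\circ(R_3\otimes B)$ (equal to $A\otimes_{T_2}(B\otimes_{R_2}C)$ with $T_2:=(R_1\otimes C)\circ(B\otimes R_3)$); it has unit $1\otimes1\otimes1$ when the twisting maps are unital, i.e. $R(1\otimes a)=a\otimes 1$, $R(b\otimes1)=1\otimes b$. *)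

theory Defs
  imports Complex_Main "HOL-Library.Poly_Mapping"
begin

section \<open>Complex vector spaces\<close>

class complex_vector = ab_group_add +
  fixes scaleC :: "complex \<Rightarrow> 'a \<Rightarrow> 'a" (infixr "*\<^sub>C" 75)
  assumes scaleC_add_right: "c *\<^sub>C (x + y) = c *\<^sub>C x + c *\<^sub>C y"
    and scaleC_add_left: "(c + d) *\<^sub>C x = c *\<^sub>C x + d *\<^sub>C x"
    and scaleC_scaleC: "c *\<^sub>C d *\<^sub>C x = (c * d) *\<^sub>C x"
    and scaleC_one: "1 *\<^sub>C x = x"

global_interpretation cvec: vector_space "scaleC :: complex \<Rightarrow> 'a \<Rightarrow> 'a::complex_vector"
  by unfold_locales (simp_all add: scaleC_add_right scaleC_add_left scaleC_scaleC scaleC_one)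

abbreviation clinear :: "('a::complex_vector \<Rightarrow> 'b::complex_vector) \<Rightarrow> bool"
  where "clinear \<equiv> Vector_Spaces.linear scaleC scaleC"

definition antilinear :: "('a::complex_vector \<Rightarrow> 'b::complex_vector) \<Rightarrow> bool"
  where "antilinear f \<longleftrightarrow>
    Modules.additive f \<and> (\<forall>c x. f (c *\<^sub>C x) = cnj c *\<^sub>C f x)"

lemma clinear_iff:
  "clinear f \<longleftrightarrow> Modules.additive f \<and> (\<forall>c x. f (c *\<^sub>C x) = c *\<^sub>C f x)"
  by (simp add: Vector_Spaces.linear_iff additive_def cvec.vector_space_axioms)


section \<open>The tensor product over the complex numbers\<close>

text \<open>The free complex vector space on a set of generators consists of the finitely supported
  functions, with pointwise operations; the tensor product is its quotient on pairs by the
  bilinearity relations.\<close>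

definition fscale :: "complex \<Rightarrow> ('x \<Rightarrow>\<^sub>0 complex) \<Rightarrow> ('x \<Rightarrow>\<^sub>0 complex)"
  where "fscale c p = Poly_Mapping.map ((*) c) p"

lemma lookup_fscale [simp]: "Poly_Mapping.lookup (fscale c p) k = c * Poly_Mapping.lookup p k"
  by (cases "Poly_Mapping.lookup p k = 0") (simp_all add: fscale_def Poly_Mapping.map.rep_eq)

global_interpretation free: vector_space fscale
  by unfold_locales (auto intro!: poly_mapping_eqI simp: lookup_add algebra_simps)

abbreviation gen :: "'x \<Rightarrow> ('x \<Rightarrow>\<^sub>0 complex)"
  where "gen x \<equiv> Poly_Mapping.single x 1"

definition tensor_relations :: "(('a::complex_vector \<times> 'b::complex_vector) \<Rightarrow>\<^sub>0 complex) set"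
  where "tensor_relations =
      {gen (a + a', b) - gen (a, b) - gen (a', b) | a a' b. True}
    \<union> {gen (a, b + b') - gen (a, b) - gen (a, b') | a b b'. True}
    \<union> {gen (c *\<^sub>C a, b) - fscale c (gen (a, b)) | a b c. True}
    \<union> {gen (a, c *\<^sub>C b) - fscale c (gen (a, b)) | a b c. True}"

definition tensor_eq ::
    "(('a::complex_vector \<times> 'b::complex_vector) \<Rightarrow>\<^sub>0 complex) \<Rightarrow> (('a \<times> 'b) \<Rightarrow>\<^sub>0 complex) \<Rightarrow> bool"
  where "tensor_eq p q \<longleftrightarrow> p - q \<in> free.span tensor_relations"

lemma equivp_tensor_eq: "equivp tensor_eq"
proof (rule equivpI)
  show "reflp tensor_eq"
    by (simp add: reflp_def tensor_eq_def free.span_zero)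
  show "symp tensor_eq"
    unfolding symp_def tensor_eq_def by (intro allI impI) (drule free.span_neg, simp)
  show "transp tensor_eq"
    unfolding transp_def tensor_eq_def by (intro allI impI) (drule (1) free.span_add, simp)
qed

quotient_type (overloaded) ('a, 'b) tensor (infixl "\<otimes>" 70) =
  "('a::complex_vector \<times> 'b::complex_vector) \<Rightarrow>\<^sub>0 complex" / tensor_eq
  by (rule equivp_tensor_eq)

instantiation tensor :: (complex_vector, complex_vector) complex_vector
begin

lift_definition zero_tensor :: "'a \<otimes> 'b" is 0 .

lift_definition plus_tensor :: "'a \<otimes> 'b \<Rightarrow> 'a \<otimes> 'b \<Rightarrow> 'a \<otimes> 'b" is "(+)"
  unfolding tensor_eq_def by (drule (1) free.span_add) (simp add: algebra_simps)

lift_definition uminus_tensor :: "'a \<otimes> 'b \<Rightarrow> 'a \<otimes> 'b" is uminus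
  unfolding tensor_eq_def by (drule free.span_neg) (simp add: algebra_simps)

lift_definition minus_tensor :: "'a \<otimes> 'b \<Rightarrow> 'a \<otimes> 'b \<Rightarrow> 'a \<otimes> 'b" is "(-)"
  unfolding tensor_eq_def by (drule (1) free.span_diff) (simp add: algebra_simps)

lift_definition scaleC_tensor :: "complex \<Rightarrow> 'a \<otimes> 'b \<Rightarrow> 'a \<otimes> 'b" is fscale
  unfolding tensor_eq_def using free.span_scale by (metis free.scale_right_diff_distrib)

instance
proof
qed (transfer, simp add: tensor_eq_def free.span_zero add_ac free.scale_right_distrib free.scale_left_distrib)+

end

lift_definition tensor_mult :: "'a::complex_vector \<Rightarrow> 'b::complex_vector \<Rightarrow> 'a \<otimes> 'b"
    (infixl "\<otimes>" 70)
  is "\<lambda>a b. gen (a, b)" .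

lemma
  fixes a a' :: "'a::complex_vector" and b b' :: "'b::complex_vector"
  shows tensor_add_left: "(a + a') \<otimes> b = a \<otimes> b + a' \<otimes> b"
    and tensor_add_right: "a \<otimes> (b + b') = a \<otimes> b + a \<otimes> b'"
    and tensor_scale_left: "(c *\<^sub>C a) \<otimes> b = c *\<^sub>C (a \<otimes> b)"
    and tensor_scale_right: "a \<otimes> (c *\<^sub>C b) = c *\<^sub>C (a \<otimes> b)"
  by (transfer, unfold tensor_eq_def,
      rule free.span_base, unfold tensor_relations_def diff_diff_eq [symmetric], blast)+

text \<open>Every tensor is a sum of pure tensors, so an additive map is determined by its values on
  pure tensors. Only additivity is required of the extension, so that linear and antilinear
  maps are covered alike.\<close>

definition tensor_lift ::
    "('a::complex_vector \<Rightarrow> 'b::complex_vector \<Rightarrow> 'c::ab_group_add) \<Rightarrow> 'a \<otimes> 'b \<Rightarrow> 'c"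
  where "tensor_lift \<beta> = (THE h. Modules.additive h \<and> (\<forall>a b. h (a \<otimes> b) = \<beta> a b))"

lemma gen_abs: "abs_tensor (gen (a, b)) = a \<otimes> b"
  by (simp add: tensor_mult.abs_eq)

lemma tensor_induct [case_names pure add]:
  fixes x :: "'a::complex_vector \<otimes> 'b::complex_vector"
  assumes pure: "\<And>a b. P (a \<otimes> b)" and add: "\<And>x y. P x \<Longrightarrow> P y \<Longrightarrow> P (x + y)"
  shows "P x"
proof -
  have single: "abs_tensor (Poly_Mapping.single (a, b) c) = (c *\<^sub>C a) \<otimes> b"
    for a :: 'a and b :: 'b and c
  proof -
    have "Poly_Mapping.single (a, b) c = fscale c (gen (a, b))"
      by (rule poly_mapping_eqI) (simp add: lookup_single when_def)
    then show ?thesis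
      by (metis gen_abs scaleC_tensor.abs_eq tensor_scale_left)
  qed
  have "P (abs_tensor p)" for p :: "('a \<times> 'b) \<Rightarrow>\<^sub>0 complex"
  proof (induction p rule: update_induct)
    case const
    have "(0 :: ('a \<times> 'b) \<Rightarrow>\<^sub>0 complex) = Poly_Mapping.single (0, 0) 0" by simp
    then show ?case using single pure by metis
  next
    case (update f k c)
    have "Poly_Mapping.update k c f = Poly_Mapping.single k c + f"
      using update(1) by (intro poly_mapping_eqI)
        (auto simp: lookup_update lookup_add lookup_single when_def in_keys_iff)
    then have "abs_tensor (Poly_Mapping.update k c f) = abs_tensor (Poly_Mapping.single k c) + abs_tensor f"
      by (simp add: plus_tensor.abs_eq)
    then show ?case
      using single[of "fst k" "snd k" c] pure add update by simp
  qed
  then show ?thesis by (metis tensor.abs_induct)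
qed

lemma additive_tensor_eqI:
  assumes "Modules.additive h" "Modules.additive h'" "\<And>a b. h (a \<otimes> b) = h' (a \<otimes> b)"
  shows "h = h'"
proof
  fix x show "h x = h' x"
    by (induction x rule: tensor_induct) (simp_all add: assms(3) assms(1,2)[THEN additive.add])
qed

lemma tensor_lift_exists:
  fixes \<beta> :: "'a::complex_vector \<Rightarrow> 'b::complex_vector \<Rightarrow> 'c::ab_group_add"
  assumes addl: "\<And>a a' b. \<beta> (a + a') b = \<beta> a b + \<beta> a' b"
    and addr: "\<And>a b b'. \<beta> a (b + b') = \<beta> a b + \<beta> a b'"
    and bal: "\<And>c a b. \<beta> (c *\<^sub>C a) b = \<beta> a (c *\<^sub>C b)"
  shows "\<exists>h. Modules.additive h \<and> (\<forall>a b. h (a \<otimes> b) = \<beta> a b)"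
proof -
  have zero: "\<beta> 0 b = 0" for b using addl[of 0 0 b] by simp
  define t where "t = (\<lambda>(k :: 'a \<times> 'b) c. \<beta> (c *\<^sub>C fst k) (snd k))"
  define F where "F p = (\<Sum>k\<in>Poly_Mapping.keys p. t k (Poly_Mapping.lookup p k))" for p :: "('a \<times> 'b) \<Rightarrow>\<^sub>0 complex"
  have t0: "t k 0 = 0" for k by (simp add: t_def zero)
  have tadd: "t k (c + d) = t k c + t k d" for k c d
    by (simp add: t_def cvec.scale_left_distrib addl)
  have F_sup: "F p = (\<Sum>k\<in>S. t k (Poly_Mapping.lookup p k))" if "finite S" "Poly_Mapping.keys p \<subseteq> S" for p S
    unfolding F_def using that
    by (intro sum.mono_neutral_left) (auto simp: in_keys_iff t0)
  have Fadd: "F (p + q) = F p + F q" for p q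
  proof -
    let ?S = "Poly_Mapping.keys p \<union> Poly_Mapping.keys q"
    have "F (p + q) = (\<Sum>k\<in>?S. t k (Poly_Mapping.lookup (p + q) k))"
      by (rule F_sup) (auto simp: keys_add)
    also have "\<dots> = F p + F q"
      by (simp add: F_sup[of ?S p] F_sup[of ?S q] lookup_add tadd sum.distrib)
    finally show ?thesis .
  qed
  interpret F: additive F by standard (rule Fadd)
  have Fsingle: "F (Poly_Mapping.single (a, b) c) = \<beta> (c *\<^sub>C a) b" for a b c
    by (subst F_sup[of "{(a, b)}"]) (auto simp: t_def)
  have sc: "fscale c (Poly_Mapping.single k d) = Poly_Mapping.single k (c * d)"
    for c d and k :: "'a \<times> 'b"
    by (auto intro!: poly_mapping_eqI simp: lookup_single when_def)
  have rel: "F (fscale d r) = 0" if "r \<in> tensor_relations" for d r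
    using that unfolding tensor_relations_def
    by (auto simp: free.scale_right_diff_distrib F.diff sc Fsingle
        cvec.scale_right_distrib addl addr bal mult.commute)
  have F0: "\<forall>d. F (fscale d r) = 0" if "r \<in> free.span tensor_relations" for r
    using that
  proof (induction rule: free.span_induct)
    case base
    then show ?case 
      by (auto simp: free.subspace_def free.scale_right_distrib F.add F.zero)
  next
    case (step x)
    then show ?case using rel by blast
  qed
  have Fcong: "F p = F q" if "tensor_eq p q" for p q
  proof -
    have "F (fscale 1 (p - q)) = 0" using that F0 unfolding tensor_eq_def by blast
    then show ?thesis by (simp add: F.diff)
  qed
  define h where "h x = F (rep_tensor x)" for x
  have habs: "h (abs_tensor p) = F p" for p
    unfolding h_def by (intro Fcong) (metis Quotient3_def Quotient3_tensor tensor.abs_eq_iff)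
  have "Modules.additive h"
  proof
    fix x y :: "'a \<otimes> 'b"
    show "h (x + y) = h x + h y"
      by (induction x rule: tensor.abs_induct, induction y rule: tensor.abs_induct)
        (simp add: plus_tensor.abs_eq habs Fadd)
  qed
  moreover have "h (a \<otimes> b) = \<beta> a b" for a b
    by (metis gen_abs habs Fsingle scaleC_one)
  ultimately show ?thesis by blast
qed

lemma
  fixes \<beta> :: "'a::complex_vector \<Rightarrow> 'b::complex_vector \<Rightarrow> 'c::ab_group_add"
  assumes "\<And>a a' b. \<beta> (a + a') b = \<beta> a b + \<beta> a' b"
    and "\<And>a b b'. \<beta> a (b + b') = \<beta> a b + \<beta> a b'"
    and "\<And>c a b. \<beta> (c *\<^sub>C a) b = \<beta> a (c *\<^sub>C b)"
  shows additive_tensor_lift: "Modules.additive (tensor_lift \<beta>)"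
    and tensor_lift_tensor: "tensor_lift \<beta> (a \<otimes> b) = \<beta> a b"
proof -
  have "\<exists>!h. Modules.additive h \<and> (\<forall>a b. h (a \<otimes> b) = \<beta> a b)"
    using tensor_lift_exists[of \<beta>, OF assms] additive_tensor_eqI by (metis (no_types, lifting))
  from theI'[OF this] show "Modules.additive (tensor_lift \<beta>)" "tensor_lift \<beta> (a \<otimes> b) = \<beta> a b"
    unfolding tensor_lift_def by blast+
qed

definition tensor_map ::
    "('a::complex_vector \<Rightarrow> 'c::complex_vector) \<Rightarrow> ('b::complex_vector \<Rightarrow> 'd::complex_vector)
      \<Rightarrow> 'a \<otimes> 'b \<Rightarrow> 'c \<otimes> 'd" (infixl "\<otimes>\<^sub>m" 70)
  where "f \<otimes>\<^sub>m g = tensor_lift (\<lambda>a b. f a \<otimes> g b)"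

definition flip :: "'a::complex_vector \<otimes> 'b::complex_vector \<Rightarrow> 'b \<otimes> 'a"
  where "flip = tensor_lift (\<lambda>a b. b \<otimes> a)"

definition assoc :: "('a::complex_vector \<otimes> 'b::complex_vector) \<otimes> 'c::complex_vector \<Rightarrow> 'a \<otimes> ('b \<otimes> 'c)"
  where "assoc = tensor_lift (\<lambda>x c. tensor_lift (\<lambda>a b. a \<otimes> (b \<otimes> c)) x)"

definition unassoc :: "'a::complex_vector \<otimes> ('b::complex_vector \<otimes> 'c::complex_vector) \<Rightarrow> ('a \<otimes> 'b) \<otimes> 'c"
  where "unassoc = tensor_lift (\<lambda>a y. tensor_lift (\<lambda>b c. (a \<otimes> b) \<otimes> c) y)"

lemma tensor_map_tensor_linear:
  assumes "clinear f" "clinear g"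
  shows "(f \<otimes>\<^sub>m g) (a \<otimes> b) = f a \<otimes> g b" and "clinear (f \<otimes>\<^sub>m g)"
proof -
  note f = assms(1)[unfolded clinear_iff] and g = assms(2)[unfolded clinear_iff]
  note l = additive_tensor_lift[of "\<lambda>a b. f a \<otimes> g b"] tensor_lift_tensor[of "\<lambda>a b. f a \<otimes> g b"]
  have ad: "Modules.additive (f \<otimes>\<^sub>m g)" and e: "(f \<otimes>\<^sub>m g) (a \<otimes> b) = f a \<otimes> g b" for a b
    unfolding tensor_map_def using f g
    by (auto intro!: l simp: additive.add tensor_add_left tensor_add_right tensor_scale_left tensor_scale_right)
  show "(f \<otimes>\<^sub>m g) (a \<otimes> b) = f a \<otimes> g b" by (rule e)
  have "(f \<otimes>\<^sub>m g) (c *\<^sub>C x) = c *\<^sub>C (f \<otimes>\<^sub>m g) x" for c x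
  proof (induction x rule: tensor_induct)
    case (pure a b)
    then show ?case using f by (metis e tensor_scale_left)
  qed (simp add: scaleC_add_right additive.add[OF ad])
  with ad show "clinear (f \<otimes>\<^sub>m g)" by (simp add: clinear_iff)
qed

lemma tensor_map_tensor_antilinear:
  assumes "antilinear f" "antilinear g"
  shows "(f \<otimes>\<^sub>m g) (a \<otimes> b) = f a \<otimes> g b" and "antilinear (f \<otimes>\<^sub>m g)"
proof -
  note f = assms(1)[unfolded antilinear_def] and g = assms(2)[unfolded antilinear_def]
  note l = additive_tensor_lift[of "\<lambda>a b. f a \<otimes> g b"] tensor_lift_tensor[of "\<lambda>a b. f a \<otimes> g b"]
  have ad: "Modules.additive (f \<otimes>\<^sub>m g)" and e: "(f \<otimes>\<^sub>m g) (a \<otimes> b) = f a \<otimes> g b" for a b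
    unfolding tensor_map_def using f g
    by (auto intro!: l simp: additive.add tensor_add_left tensor_add_right tensor_scale_left tensor_scale_right)
  show "(f \<otimes>\<^sub>m g) (a \<otimes> b) = f a \<otimes> g b" by (rule e)
  have "(f \<otimes>\<^sub>m g) (c *\<^sub>C x) = cnj c *\<^sub>C (f \<otimes>\<^sub>m g) x" for c x
  proof (induction x rule: tensor_induct)
    case (pure a b)
    then show ?case using f by (metis e tensor_scale_left)
  qed (simp add: scaleC_add_right additive.add[OF ad])
  with ad show "antilinear (f \<otimes>\<^sub>m g)" by (simp add: antilinear_def)
qed

lemma flip_tensor: "flip (a \<otimes> b) = b \<otimes> a"
  unfolding flip_def
  by (rule tensor_lift_tensor)
    (simp_all add: tensor_add_left tensor_add_right tensor_scale_left tensor_scale_right)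

lemma assoc_tensor: "assoc (((a::'a::complex_vector) \<otimes> (b::'b::complex_vector)) \<otimes> (c::'c::complex_vector)) = a \<otimes> (b \<otimes> c)"
proof -
  note s = tensor_add_left tensor_add_right tensor_scale_left tensor_scale_right
  define T :: "'c \<Rightarrow> 'a \<otimes> 'b \<Rightarrow> 'a \<otimes> ('b \<otimes> 'c)"
    where "T c = tensor_lift (\<lambda>a b. a \<otimes> (b \<otimes> c))" for c
  have ad: "Modules.additive (T c)" and e: "T c (a \<otimes> b) = a \<otimes> (b \<otimes> c)" for a b c
    unfolding T_def by (auto intro!: additive_tensor_lift tensor_lift_tensor simp: s)
  have 1: "T (c + d) x = T c x + T d x" for c d x
    by (induction x rule: tensor_induct) (simp_all add: e s additive.add[OF ad])
  have 2: "T (k *\<^sub>C v) x = k *\<^sub>C T v x" for v k x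
    by (induction x rule: tensor_induct)
      (simp_all add: e s scaleC_add_right additive.add[OF ad])
  have 3: "T v (k *\<^sub>C x) = k *\<^sub>C T v x" for v k x
  proof (induction x rule: tensor_induct)
    case (pure a b)
    show ?case by (metis e tensor_scale_left tensor_scale_right)
  qed (simp add: scaleC_add_right additive.add[OF ad])
  show ?thesis
    unfolding assoc_def T_def [symmetric]
    by (subst tensor_lift_tensor) (simp_all add: e 1 2 3 additive.add[OF ad])
qed

lemma unassoc_tensor: "unassoc ((a::'a::complex_vector) \<otimes> ((b::'b::complex_vector) \<otimes> (c::'c::complex_vector))) = (a \<otimes> b) \<otimes> c"
proof -
  note s = tensor_add_left tensor_add_right tensor_scale_left tensor_scale_right
  define T :: "'a \<Rightarrow> 'b \<otimes> 'c \<Rightarrow> ('a \<otimes> 'b) \<otimes> 'c"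
    where "T a = tensor_lift (\<lambda>b c. (a \<otimes> b) \<otimes> c)" for a
  have ad: "Modules.additive (T a)" and e: "T a (b \<otimes> c) = (a \<otimes> b) \<otimes> c" for a b c
    unfolding T_def by (auto intro!: additive_tensor_lift tensor_lift_tensor simp: s)
  have 1: "T (a + d) x = T a x + T d x" for a d x
    by (induction x rule: tensor_induct) (simp_all add: e s additive.add[OF ad])
  have 2: "T (k *\<^sub>C v) x = k *\<^sub>C T v x" for v k x
    by (induction x rule: tensor_induct)
      (simp_all add: e s scaleC_add_right additive.add[OF ad])
  have 3: "T v (k *\<^sub>C x) = k *\<^sub>C T v x" for v k x
  proof (induction x rule: tensor_induct)
    case (pure a b)
    show ?case by (metis e tensor_scale_left tensor_scale_right)
  qed (simp add: scaleC_add_right additive.add[OF ad])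
  show ?thesis
    unfolding unassoc_def T_def [symmetric]
    by (subst tensor_lift_tensor) (simp_all add: e 1 2 3 additive.add[OF ad])
qed


section \<open>Algebras, star-algebras and twisting maps\<close>

text \<open>The product is a linear map on the tensor square. The zero algebra is allowed.\<close>

locale complex_algebra =
  fixes \<mu> :: "'a::complex_vector \<otimes> 'a \<Rightarrow> 'a" and e :: 'a
  assumes linear_mult: "clinear \<mu>"
    and mult_assoc: "\<mu> (\<mu> (x \<otimes> y) \<otimes> z) = \<mu> (x \<otimes> \<mu> (y \<otimes> z))"
    and mult_unit_left: "\<mu> (e \<otimes> x) = x"
    and mult_unit_right: "\<mu> (x \<otimes> e) = x"

locale star_algebra = complex_algebra +
  fixes j :: "'a::complex_vector \<Rightarrow> 'a"
  assumes antilinear_star: "antilinear j"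
    and star_mult: "j (\<mu> (x \<otimes> y)) = \<mu> (j y \<otimes> j x)"
    and star_star: "j \<circ> j = id"

text \<open>Unparenthesised multiple tensor products are read as bracketed to the left; \<open>assoc\<close> and
  \<open>unassoc\<close> make the identifications explicit. Unitality is not part of the definition of a
  twisting map.\<close>

locale twisting_map =
  fixes \<mu>A :: "'a::complex_vector \<otimes> 'a \<Rightarrow> 'a"
    and \<mu>B :: "'b::complex_vector \<otimes> 'b \<Rightarrow> 'b"
    and R :: "'b \<otimes> 'a \<Rightarrow> 'a \<otimes> 'b"
  assumes linear_twist: "clinear R"
    and twist_left: "R \<circ> (id \<otimes>\<^sub>m \<mu>A) \<circ> assoc =
      (\<mu>A \<otimes>\<^sub>m id) \<circ> unassoc \<circ> (id \<otimes>\<^sub>m R) \<circ> assoc \<circ> (R \<otimes>\<^sub>m id)"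
    and twist_right: "R \<circ> (\<mu>B \<otimes>\<^sub>m id) =
      (id \<otimes>\<^sub>m \<mu>B) \<circ> assoc \<circ> (R \<otimes>\<^sub>m id) \<circ> unassoc \<circ> (id \<otimes>\<^sub>m R) \<circ> assoc"

text \<open>\<open>mid_map f\<close> is the map written \<open>X \<otimes> f\<close> on a triple tensor product bracketed to the left.\<close>

definition mid_map ::
    "('b::complex_vector \<otimes> 'c::complex_vector \<Rightarrow> 'd::complex_vector \<otimes> 'e::complex_vector)
      \<Rightarrow> ('a::complex_vector \<otimes> 'b) \<otimes> 'c \<Rightarrow> ('a \<otimes> 'd) \<otimes> 'e"
  where "mid_map f = unassoc \<circ> (id \<otimes>\<^sub>m f) \<circ> assoc"

definition twisted_mult ::
    "('a::complex_vector \<otimes> 'a \<Rightarrow> 'a) \<Rightarrow> ('b::complex_vector \<otimes> 'b \<Rightarrow> 'b) \<Rightarrow> ('b \<otimes> 'a \<Rightarrow> 'a \<otimes> 'b)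
      \<Rightarrow> ('a \<otimes> 'b) \<otimes> ('a \<otimes> 'b) \<Rightarrow> 'a \<otimes> 'b"
  where "twisted_mult \<mu>A \<mu>B R =
    (\<mu>A \<otimes>\<^sub>m \<mu>B) \<circ> assoc \<circ> (mid_map R \<otimes>\<^sub>m id) \<circ> unassoc"

text \<open>Both sides of the hexagon equation are maps from \<open>(C \<otimes> B) \<otimes> A\<close> to \<open>(A \<otimes> B) \<otimes> C\<close>.\<close>

definition compatible ::
    "('b::complex_vector \<otimes> 'a::complex_vector \<Rightarrow> 'a \<otimes> 'b)
      \<Rightarrow> ('c::complex_vector \<otimes> 'b \<Rightarrow> 'b \<otimes> 'c) \<Rightarrow> ('c \<otimes> 'a \<Rightarrow> 'a \<otimes> 'c) \<Rightarrow> bool"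
  where "compatible R1 R2 R3 \<longleftrightarrow>
    mid_map R2 \<circ> (R3 \<otimes>\<^sub>m id) \<circ> mid_map R1 = (R1 \<otimes>\<^sub>m id) \<circ> mid_map R3 \<circ> (R2 \<otimes>\<^sub>m id)"

definition iterated_twist ::
    "('c::complex_vector \<otimes> 'b::complex_vector \<Rightarrow> 'b \<otimes> 'c)
      \<Rightarrow> ('c \<otimes> 'a::complex_vector \<Rightarrow> 'a \<otimes> 'c) \<Rightarrow> 'c \<otimes> ('a \<otimes> 'b) \<Rightarrow> ('a \<otimes> 'b) \<otimes> 'c"
  where "iterated_twist R2 R3 = mid_map R2 \<circ> (R3 \<otimes>\<^sub>m id) \<circ> unassoc"

text \<open>The product of \<open>(A \<otimes>\<^sub>R\<^sub>1 B) \<otimes>\<^sub>T\<^sub>1 C\<close>, where \<open>T\<^sub>1 = (A \<otimes> R\<^sub>2) \<circ> (R\<^sub>3 \<otimes> B)\<close> is \<open>iterated_twist\<close>.\<close>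

definition iterated_mult ::
    "('a::complex_vector \<otimes> 'a \<Rightarrow> 'a) \<Rightarrow> ('b::complex_vector \<otimes> 'b \<Rightarrow> 'b)
      \<Rightarrow> ('c::complex_vector \<otimes> 'c \<Rightarrow> 'c)
      \<Rightarrow> ('b \<otimes> 'a \<Rightarrow> 'a \<otimes> 'b) \<Rightarrow> ('c \<otimes> 'b \<Rightarrow> 'b \<otimes> 'c) \<Rightarrow> ('c \<otimes> 'a \<Rightarrow> 'a \<otimes> 'c)
      \<Rightarrow> (('a \<otimes> 'b) \<otimes> 'c) \<otimes> (('a \<otimes> 'b) \<otimes> 'c) \<Rightarrow> ('a \<otimes> 'b) \<otimes> 'c"
  where "iterated_mult \<mu>A \<mu>B \<mu>C R1 R2 R3 =
    twisted_mult (twisted_mult \<mu>A \<mu>B R1) \<mu>C (iterated_twist R2 R3)"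

end

theory Submission
  imports Defs
begin

text \<open>For two factors, the product of \<open>A \<otimes>\<^sub>R B\<close> is
  \<open>(a \<otimes> b)(a' \<otimes> b') = a \<cdot> R (b \<otimes> a') \<cdot> b'\<close>, and the twisting laws say that \<open>R\<close> turns
  multiplication in \<open>A\<close> and \<open>B\<close> into right and left multiplication in \<open>A \<otimes>\<^sub>R B\<close>; together with
  \<open>j \<circ> j = id\<close> this makes \<open>j = R \<circ> (j\<^sub>B \<otimes> j\<^sub>A) \<circ> \<tau>\<close> antimultiplicative. The same condition forces
  \<open>R\<close> to be surjective, hence unital. For three factors, compatibility makes
  \<open>T\<^sub>1 = (A \<otimes> R\<^sub>2) \<circ> (R\<^sub>3 \<otimes> B)\<close> a twisting map between \<open>A \<otimes>\<^sub>R\<^sub>1 B\<close> and \<open>C\<close> that satisfies the involution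
  condition again, so the two-factor case applies a second time.\<close>

section \<open>Linear maps on tensor products\<close>

lemma clinearI:
  assumes "\<And>x y. f (x + y) = f x + f y" and "\<And>c x. f (c *\<^sub>C x) = c *\<^sub>C f x"
  shows "clinear f"
  using assms by (simp add: clinear_iff additive_def)

lemma clinear_add: "clinear f \<Longrightarrow> f (x + y) = f x + f y"
  by (simp add: clinear_iff additive.add)

lemma clinear_scaleC: "clinear f \<Longrightarrow> f (c *\<^sub>C x) = c *\<^sub>C f x"
  by (simp add: clinear_iff)

lemma clinear_comp: "clinear g \<Longrightarrow> clinear f \<Longrightarrow> clinear (g \<circ> f)"
  by (rule Vector_Spaces.linear_compose)

lemma clinear_id: "clinear id"
  by (rule clinearI) simp_all

lemma antilinear_add: "antilinear f \<Longrightarrow> f (x + y) = f x + f y"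
  by (simp add: antilinear_def additive.add)

lemma antilinear_comp: "clinear g \<Longrightarrow> antilinear f \<Longrightarrow> antilinear (g \<circ> f)"
  by (simp add: antilinear_def additive_def clinear_add clinear_scaleC)

lemma antilinear_comp_clinear: "antilinear g \<Longrightarrow> clinear f \<Longrightarrow> antilinear (g \<circ> f)"
  by (simp add: antilinear_def additive_def clinear_add clinear_scaleC)

lemmas tensor_bilinear = tensor_add_left tensor_add_right tensor_scale_left tensor_scale_right

lemma clinear_tensor_lift:
  assumes l: "\<And>b. clinear (\<lambda>a. \<beta> a b)" and r: "\<And>a. clinear (\<beta> a)"
  shows "clinear (tensor_lift \<beta>)"
proof -
  note s = clinear_add[OF l] clinear_add[OF r] clinear_scaleC[OF l] clinear_scaleC[OF r]
  have ad: "Modules.additive (tensor_lift \<beta>)" and e: "tensor_lift \<beta> (a \<otimes> b) = \<beta> a b" for a b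
    by (auto intro!: additive_tensor_lift tensor_lift_tensor simp: s)
  show ?thesis
  proof (rule clinearI)
    fix c x show "tensor_lift \<beta> (c *\<^sub>C x) = c *\<^sub>C tensor_lift \<beta> x"
    proof (induction x rule: tensor_induct)
      case (pure a b)
      then show ?case by (metis e s(3) tensor_scale_left)
    qed (simp add: scaleC_add_right additive.add[OF ad])
  qed (rule additive.add[OF ad])
qed

lemma clinear_tensor_left: "clinear (\<lambda>a. a \<otimes> b)"
  and clinear_tensor_right: "clinear (\<lambda>b. a \<otimes> b)"
  by (auto intro!: clinearI simp: tensor_bilinear)

lemma clinear_flip: "clinear flip"
  unfolding flip_def by (intro clinear_tensor_lift clinear_tensor_left clinear_tensor_right)

lemma
  assumes "clinear f"
  shows map_id_tensor: "(f \<otimes>\<^sub>m id) (a \<otimes> b) = f a \<otimes> b"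
    and id_map_tensor: "(id \<otimes>\<^sub>m f) (b \<otimes> a) = b \<otimes> f a"
    and clinear_map_id: "clinear (f \<otimes>\<^sub>m id)"
    and clinear_id_map: "clinear (id \<otimes>\<^sub>m f)"
  using assms by (simp_all only: tensor_map_tensor_linear clinear_id id_apply)

lemma clinear_assoc: "clinear assoc"
proof -
  \<comment> \<open>As a tensor product of linear maps, \<open>T c\<close> is linear with no further
    work; only linearity in \<open>c\<close> is left to an induction.\<close>
  define T :: "'c \<Rightarrow> 'a \<otimes> 'b \<Rightarrow> 'a \<otimes> ('b \<otimes> 'c)" where "T c = id \<otimes>\<^sub>m (\<lambda>b. b \<otimes> c)" for c
  have lin: "clinear (T c)" and T: "T c (a \<otimes> b) = a \<otimes> (b \<otimes> c)" for a b c
    unfolding T_def by (intro clinear_id_map id_map_tensor clinear_tensor_left)+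
  have "clinear (\<lambda>c. T c x)" for x
  proof (rule clinearI)
    fix c d k
    show "T (c + d) x = T c x + T d x" and "T (k *\<^sub>C c) x = k *\<^sub>C T c x"
      by (induction x rule: tensor_induct)
        (simp_all add: T tensor_bilinear clinear_add[OF lin] scaleC_add_right)
  qed
  moreover have "assoc = tensor_lift (\<lambda>x c. T c x)"
    unfolding assoc_def T_def tensor_map_def id_apply ..
  ultimately show ?thesis
    using clinear_tensor_lift[of "\<lambda>x c. T c x"] lin by simp
qed

lemma clinear_unassoc: "clinear unassoc"
proof -
  define T :: "'a \<Rightarrow> 'b \<otimes> 'c \<Rightarrow> ('a \<otimes> 'b) \<otimes> 'c" where "T a = (\<lambda>b. a \<otimes> b) \<otimes>\<^sub>m id" for a
  have lin: "clinear (T a)" and T: "T a (b \<otimes> c) = (a \<otimes> b) \<otimes> c" for a b c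
    unfolding T_def by (intro clinear_map_id map_id_tensor clinear_tensor_right)+
  have "clinear (\<lambda>a. T a x)" for x
  proof (rule clinearI)
    fix c d k
    show "T (c + d) x = T c x + T d x" and "T (k *\<^sub>C c) x = k *\<^sub>C T c x"
      by (induction x rule: tensor_induct)
        (simp_all add: T tensor_bilinear clinear_add[OF lin] scaleC_add_right)
  qed
  moreover have "unassoc = tensor_lift T"
    unfolding unassoc_def T_def tensor_map_def id_apply ..
  ultimately show ?thesis
    using clinear_tensor_lift[of T] lin by simp
qed

lemmas assoc_add = clinear_add[OF clinear_assoc]
  and unassoc_add = clinear_add[OF clinear_unassoc]

lemma clinear_mid_map: "clinear f \<Longrightarrow> clinear (mid_map f)"
  unfolding mid_map_def
  by (intro clinear_comp clinear_unassoc clinear_assoc tensor_map_tensor_linear clinear_id)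

lemma mid_map_tensor: "clinear f \<Longrightarrow> mid_map f (a \<otimes> b \<otimes> c) = unassoc (a \<otimes> f (b \<otimes> c))"
  by (simp add: mid_map_def assoc_tensor tensor_map_tensor_linear clinear_id)

lemma clinear_twisted_mult:
  assumes "clinear \<mu>A" "clinear \<mu>B" "clinear R"
  shows "clinear (twisted_mult \<mu>A \<mu>B R)"
  unfolding twisted_mult_def using assms
  by (intro clinear_comp clinear_unassoc clinear_assoc tensor_map_tensor_linear clinear_id
      clinear_mid_map)

section \<open>Two factors\<close>

locale twisted_algebra =
  A: complex_algebra \<mu>A eA + B: complex_algebra \<mu>B eB + twisting_map \<mu>A \<mu>B R
  for \<mu>A :: "'a::complex_vector \<otimes> 'a \<Rightarrow> 'a" and eA
    and \<mu>B :: "'b::complex_vector \<otimes> 'b \<Rightarrow> 'b" and eB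
    and R :: "'b \<otimes> 'a \<Rightarrow> 'a \<otimes> 'b"
begin

abbreviation m where "m \<equiv> twisted_mult \<mu>A \<mu>B R"

text \<open>The map \<open>w \<mapsto> a \<cdot> w \<cdot> b\<close> of the \<open>(A, B)\<close>-bimodule \<open>A \<otimes> B\<close>.\<close>

definition act :: "'a \<Rightarrow> 'b \<Rightarrow> 'a \<otimes> 'b \<Rightarrow> 'a \<otimes> 'b"
  where "act a b = (\<lambda>x. \<mu>A (a \<otimes> x)) \<otimes>\<^sub>m (\<lambda>y. \<mu>B (y \<otimes> b))"

lemma clinear_m: "clinear m"
  by (rule clinear_twisted_mult[OF A.linear_mult B.linear_mult linear_twist])

lemma mult_linear: "clinear (\<lambda>x. \<mu>A (a \<otimes> x))" "clinear (\<lambda>y. \<mu>B (y \<otimes> b))"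
  by (auto intro!: clinearI simp: tensor_bilinear clinear_add[OF A.linear_mult]
      clinear_scaleC[OF A.linear_mult] clinear_add[OF B.linear_mult] clinear_scaleC[OF B.linear_mult])

lemma act_tensor: "act a b (x \<otimes> y) = \<mu>A (a \<otimes> x) \<otimes> \<mu>B (y \<otimes> b)"
  and clinear_act: "clinear (act a b)"
  unfolding act_def by (intro tensor_map_tensor_linear mult_linear)+

lemmas add_simps = clinear_add[OF clinear_act] clinear_add[OF clinear_m]
  clinear_add[OF linear_twist] clinear_add[OF A.linear_mult] clinear_add[OF B.linear_mult]
  tensor_add_left tensor_add_right assoc_add unassoc_add

lemma act_act: "act a b (act a' b' w) = act (\<mu>A (a \<otimes> a')) (\<mu>B (b' \<otimes> b)) w"
  by (induction w rule: tensor_induct)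
    (simp_all add: act_tensor add_simps A.mult_assoc B.mult_assoc)

lemma act_unit: "act eA eB w = w"
  by (induction w rule: tensor_induct)
    (simp_all add: act_tensor add_simps A.mult_unit_left B.mult_unit_right)

text \<open>The inner twist yields a tensor that need not be pure, so the outer factors are recorded
  by \<open>act\<close>. Later computations with the product start from this bimodule form.\<close>

lemma m_tensor: "m ((a \<otimes> b) \<otimes> (a' \<otimes> b')) = act a b' (R (b \<otimes> a'))"
proof -
  note l = tensor_map_tensor_linear[OF A.linear_mult B.linear_mult]
  have "(\<mu>A \<otimes>\<^sub>m \<mu>B) (assoc (unassoc (a \<otimes> w) \<otimes> b')) = act a b' w" for w
    by (induction w rule: tensor_induct)
      (simp_all add: unassoc_tensor assoc_tensor l act_tensor add_simps clinear_add[OF l(2)])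
  then show ?thesis
    by (simp add: twisted_mult_def unassoc_tensor map_id_tensor[OF clinear_mid_map] linear_twist
        mid_map_tensor)
qed

text \<open>On pure tensors the product is itself an \<open>act\<close>, and successive actions
  merge by \<open>act_act\<close>: \<open>a\<close> meets only the left end of \<open>x\<close>, and
  \<open>b\<close> only the right end of \<open>y\<close>.\<close>

lemma act_m: "act a b (m (x \<otimes> y)) = m (act a eB x \<otimes> act eA b y)"
proof (induction x rule: tensor_induct)
  case (pure p q)
  show ?case
    by (induction y rule: tensor_induct)
      (simp_all add: m_tensor act_tensor act_act add_simps A.mult_unit_left B.mult_unit_right)
qed (simp add: add_simps)

lemmas map_simps =
  map_id_tensor[OF A.linear_mult] map_id_tensor[OF B.linear_mult] map_id_tensor[OF linear_twist]
  id_map_tensor[OF A.linear_mult] id_map_tensor[OF B.linear_mult] id_map_tensor[OF linear_twist]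
  clinear_add[OF clinear_map_id[OF A.linear_mult]] clinear_add[OF clinear_id_map[OF B.linear_mult]]
  clinear_add[OF clinear_map_id[OF linear_twist]] clinear_add[OF clinear_id_map[OF linear_twist]]

text \<open>Induction goals contain the eta-expanded form of \<open>id\<close>, which \<open>id_apply\<close> would destroy.\<close>

lemma left_act: "(\<mu>A \<otimes>\<^sub>m id) (unassoc (x \<otimes> w)) = act x eB w"
  by (induction w rule: tensor_induct)
    (simp_all add: unassoc_tensor act_tensor add_simps map_simps B.mult_unit_right del: id_apply)

lemma right_act: "(id \<otimes>\<^sub>m \<mu>B) (assoc (w \<otimes> y)) = act eA y w"
  by (induction w rule: tensor_induct)
    (simp_all add: assoc_tensor act_tensor add_simps map_simps A.mult_unit_left del: id_apply)

text \<open>This is the first twisting law on pure tensors: once \<open>R\<close> has moved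
  \<open>b\<close> past \<open>a\<close>, what remains amounts to right multiplication by
  \<open>a' \<otimes> eB\<close>. The second law gives the mirror image
  \<open>R_mult_left\<close>.\<close>

lemma R_mult_right: "R (b \<otimes> \<mu>A (a \<otimes> a')) = m (R (b \<otimes> a) \<otimes> (a' \<otimes> eB))"
proof -
  \<comment> \<open>Here \<open>z\<close> stands for \<open>R (b \<otimes> a)\<close>; leaving it
    arbitrary makes induction on tensors possible.\<close>
  have *: "(\<mu>A \<otimes>\<^sub>m id) (unassoc ((id \<otimes>\<^sub>m R) (assoc (z \<otimes> a')))) = m (z \<otimes> (a' \<otimes> eB))" for z
    by (induction z rule: tensor_induct) (simp_all add: assoc_tensor left_act m_tensor add_simps map_simps del: id_apply)
  show ?thesis
    using fun_cong[OF twist_left, of "b \<otimes> a \<otimes> a'"] by (simp add: map_simps assoc_tensor *)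
qed

lemma R_mult_left: "R (\<mu>B (b \<otimes> b') \<otimes> a) = m ((eA \<otimes> b) \<otimes> R (b' \<otimes> a))"
proof -
  have *: "(id \<otimes>\<^sub>m \<mu>B) (assoc ((R \<otimes>\<^sub>m id) (unassoc (b \<otimes> z)))) = m ((eA \<otimes> b) \<otimes> z)" for z
    by (induction z rule: tensor_induct) (simp_all add: unassoc_tensor right_act m_tensor add_simps map_simps del: id_apply)
  show ?thesis
    using fun_cong[OF twist_right, of "b \<otimes> b' \<otimes> a"] by (simp add: map_simps assoc_tensor *)
qed

text \<open>For pure \<open>w\<close>, \<open>R_mult_right\<close> takes the first component of
  \<open>w\<close> out of \<open>R\<close>, and \<open>act_m\<close> reassembles the rest. Together
  with \<open>m_act_left\<close> this drives associativity.\<close>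

lemma m_act_right: "m ((p \<otimes> q) \<otimes> act a b w) = act p b (m (R (q \<otimes> a) \<otimes> w))"
proof (induction w rule: tensor_induct)
  case (pure x y)
  have "m ((p \<otimes> q) \<otimes> act a b (x \<otimes> y)) = act p (\<mu>B (y \<otimes> b)) (m (R (q \<otimes> a) \<otimes> (x \<otimes> eB)))"
    by (simp add: act_tensor m_tensor R_mult_right)
  also have "\<dots> = act p b (m (R (q \<otimes> a) \<otimes> (x \<otimes> y)))"
    by (simp add: act_m act_tensor A.mult_unit_left B.mult_unit_left)
  finally show ?case .
qed (simp add: add_simps)

lemma m_act_left: "m (act a b w \<otimes> (p \<otimes> q)) = act a q (m (w \<otimes> R (b \<otimes> p)))"
proof (induction w rule: tensor_induct)
  case (pure x y)
  have "m (act a b (x \<otimes> y) \<otimes> (p \<otimes> q)) = act (\<mu>A (a \<otimes> x)) q (m ((eA \<otimes> y) \<otimes> R (b \<otimes> p)))"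
    by (simp add: act_tensor m_tensor R_mult_left)
  also have "\<dots> = act a q (m ((x \<otimes> y) \<otimes> R (b \<otimes> p)))"
    by (simp add: act_m act_tensor A.mult_unit_right B.mult_unit_right)
  finally show ?case .
qed (simp add: add_simps)

text \<open>On pure tensors both bracketings equal \<open>a \<cdot> (R (b \<otimes> a') \<star> R (b' \<otimes> a'')) \<cdot> b''\<close>, where
  \<open>\<star>\<close> is the twisted product.\<close>

lemma m_assoc: "m (m (x \<otimes> y) \<otimes> z) = m (x \<otimes> m (y \<otimes> z))"
proof (induction x rule: tensor_induct)
  case x: (pure a b)
  show ?case
  proof (induction y rule: tensor_induct)
    case y: (pure a' b')
    show ?case
      by (induction z rule: tensor_induct)
        (simp_all add: m_tensor m_act_left m_act_right add_simps)
  qed (simp add: add_simps)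
qed (simp add: add_simps)

text \<open>The map \<open>x \<otimes> y \<mapsto> R (1 \<otimes> x) \<cdot> y\<close> fixes the range of \<open>R\<close>, hence is the identity when \<open>R\<close> is
  surjective; this is how unitality follows without being assumed.\<close>

lemma twist_unit:
  assumes "surj R"
  shows "R (eB \<otimes> a) = a \<otimes> eB" "R (b \<otimes> eA) = eA \<otimes> b"
proof -
  have l: "m ((eA \<otimes> eB) \<otimes> R w) = R w" for w
  proof (induction w rule: tensor_induct)
    case (pure y x)
    show ?case by (metis R_mult_left B.mult_unit_left)
  qed (simp add: add_simps)
  have r: "m (R w \<otimes> (eA \<otimes> eB)) = R w" for w
  proof (induction w rule: tensor_induct)
    case (pure y x)
    show ?case by (metis R_mult_right A.mult_unit_right)
  qed (simp add: add_simps)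
  show "R (eB \<otimes> a) = a \<otimes> eB"
    by (metis l m_tensor act_unit surjD[OF assms])
  show "R (b \<otimes> eA) = eA \<otimes> b"
    by (metis r m_tensor act_unit surjD[OF assms])
qed

lemma complex_algebra_m:
  assumes "surj R"
  shows "complex_algebra m (eA \<otimes> eB)"
proof (rule complex_algebra.intro)
  fix x
  show "m ((eA \<otimes> eB) \<otimes> x) = x"
    by (induction x rule: tensor_induct)
      (simp_all add: m_tensor twist_unit[OF assms] act_tensor A.mult_unit_left B.mult_unit_left add_simps)
  show "m (x \<otimes> (eA \<otimes> eB)) = x"
    by (induction x rule: tensor_induct)
      (simp_all add: m_tensor twist_unit[OF assms] act_tensor A.mult_unit_right B.mult_unit_right add_simps)
qed (simp_all add: m_assoc clinear_m)

end

section \<open>The involution on two factors\<close>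

definition twisted_star ::
    "('b::complex_vector \<otimes> 'a::complex_vector \<Rightarrow> 'a \<otimes> 'b) \<Rightarrow> ('a \<Rightarrow> 'a) \<Rightarrow> ('b \<Rightarrow> 'b)
      \<Rightarrow> 'a \<otimes> 'b \<Rightarrow> 'a \<otimes> 'b"
  where "twisted_star R jA jB = R \<circ> (jB \<otimes>\<^sub>m jA) \<circ> flip"

locale twisted_star_algebra =
  A: star_algebra \<mu>A eA jA + B: star_algebra \<mu>B eB jB + twisting_map \<mu>A \<mu>B R
  for \<mu>A :: "'a::complex_vector \<otimes> 'a \<Rightarrow> 'a" and eA jA
    and \<mu>B :: "'b::complex_vector \<otimes> 'b \<Rightarrow> 'b" and eB jB
    and R :: "'b \<otimes> 'a \<Rightarrow> 'a \<otimes> 'b" +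
  assumes twisted_star_involution: "twisted_star R jA jB \<circ> twisted_star R jA jB = id"
begin

sublocale twisted_algebra ..

abbreviation j where "j \<equiv> twisted_star R jA jB"

lemma antilinear_j: "antilinear j"
  unfolding twisted_star_def
  by (intro antilinear_comp_clinear antilinear_comp tensor_map_tensor_antilinear linear_twist
      A.antilinear_star B.antilinear_star clinear_flip)

lemma j_tensor: "j (a \<otimes> b) = R (jB b \<otimes> jA a)"
  by (simp add: twisted_star_def flip_tensor
      tensor_map_tensor_antilinear[OF B.antilinear_star A.antilinear_star])

lemma j_j: "j (j x) = x"
  using fun_cong[OF twisted_star_involution, of x] by simp

lemma jA_jA: "jA (jA a) = a" and jB_jB: "jB (jB b) = b"
  using fun_cong[OF A.star_star, of a] fun_cong[OF B.star_star, of b] by simp_all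

text \<open>The argument of \<open>j\<close> is already \<open>j (jA a \<otimes> jB b)\<close>, so
  the involution condition cancels \<open>R\<close>. Later computations use the condition in this
  form.\<close>

lemma j_R: "j (R (b \<otimes> a)) = jA a \<otimes> jB b"
  by (metis j_j j_tensor jA_jA jB_jB)

text \<open>The involution \<open>j\<close> is onto and factors through \<open>R\<close>.\<close>

lemma surj_R: "surj R"
proof
  show "UNIV \<subseteq> range R"
  proof
    fix x
    have "x = R ((jB \<otimes>\<^sub>m jA) (flip (j x)))"
      using j_j[of x] by (simp add: twisted_star_def)
    then show "x \<in> range R" by (rule range_eqI)
  qed
qed simp

text \<open>Since \<open>jA\<close> and \<open>jB\<close> reverse products, \<open>jB b\<close>
  becomes the leftmost and \<open>jA a\<close> the rightmost factor inside \<open>R\<close>; the two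
  twisting laws then pull them out on either side.\<close>

lemma j_act: "j (act a b w) = m ((eA \<otimes> jB b) \<otimes> m (j w \<otimes> (jA a \<otimes> eB)))"
  by (induction w rule: tensor_induct)
    (simp_all add: act_tensor j_tensor A.star_mult B.star_mult R_mult_left R_mult_right m_assoc
      antilinear_add[OF antilinear_j] add_simps)

text \<open>For pure tensors \<open>j_act\<close> and \<open>j_R\<close> reduce the left side to a
  product without \<open>R\<close>, and \<open>m_act_right\<close> recreates the two twists that
  make up \<open>j y\<close> and \<open>j x\<close>.\<close>

lemma j_m: "j (m (x \<otimes> y)) = m (j y \<otimes> j x)"
proof (induction x rule: tensor_induct)
  case x: (pure a b)
  show ?case
  proof (induction y rule: tensor_induct)
    case y: (pure a' b')
    show ?case
      by (simp add: m_tensor j_act j_R j_tensor m_act_right act_unit)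
  qed (simp add: antilinear_add[OF antilinear_j] add_simps)
qed (simp add: antilinear_add[OF antilinear_j] add_simps)

lemma star_algebra_m: "star_algebra m (eA \<otimes> eB) j"
proof -
  interpret complex_algebra m "eA \<otimes> eB" by (rule complex_algebra_m[OF surj_R])
  show ?thesis by standard (rule antilinear_j j_m twisted_star_involution)+
qed

end

section \<open>Three factors\<close>

locale twisted_triple =
  R1: twisted_algebra \<mu>A eA \<mu>B eB R1 + R2: twisted_algebra \<mu>B eB \<mu>C eC R2 +
  R3: twisted_algebra \<mu>A eA \<mu>C eC R3
  for \<mu>A :: "'a::complex_vector \<otimes> 'a \<Rightarrow> 'a" and eA
    and \<mu>B :: "'b::complex_vector \<otimes> 'b \<Rightarrow> 'b" and eB
    and \<mu>C :: "'c::complex_vector \<otimes> 'c \<Rightarrow> 'c" and eC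
    and R1 :: "'b \<otimes> 'a \<Rightarrow> 'a \<otimes> 'b"
    and R2 :: "'c \<otimes> 'b \<Rightarrow> 'b \<otimes> 'c"
    and R3 :: "'c \<otimes> 'a \<Rightarrow> 'a \<otimes> 'c" +
  assumes compatible: "compatible R1 R2 R3"
begin

abbreviation T where "T \<equiv> iterated_twist R2 R3"

lemma linear_T: "clinear T"
  unfolding iterated_twist_def
  by (intro clinear_comp clinear_mid_map clinear_map_id clinear_unassoc R2.linear_twist R3.linear_twist)

lemma T_tensor: "T (c \<otimes> (a \<otimes> b)) = mid_map R2 (R3 (c \<otimes> a) \<otimes> b)"
  by (simp add: iterated_twist_def unassoc_tensor R3.map_simps)

lemma mid_R2: "mid_map R2 ((p \<otimes> q) \<otimes> b) = unassoc (p \<otimes> R2 (q \<otimes> b))"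
  and mid_R3: "mid_map R3 ((p' \<otimes> q) \<otimes> a) = unassoc (p' \<otimes> R3 (q \<otimes> a))"
  and mid_R1: "mid_map R1 ((q' \<otimes> b) \<otimes> a) = unassoc (q' \<otimes> R1 (b \<otimes> a))"
  by (simp_all add: mid_map_tensor R1.linear_twist R2.linear_twist R3.linear_twist)

text \<open>Compatibility on a pure tensor: instead of twisting \<open>b\<close> with
  \<open>a\<close> first, \<open>c\<close> may pass \<open>b\<close>, then \<open>a\<close>, with
  \<open>R1\<close> applied last.\<close>

lemma hexagon: "T (c \<otimes> R1 (b \<otimes> a)) = (R1 \<otimes>\<^sub>m id) (mid_map R3 (R2 (c \<otimes> b) \<otimes> a))"
  using fun_cong[OF compatible[unfolded compatible_def], of "c \<otimes> b \<otimes> a"]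
  by (simp add: mid_R1 R2.map_simps iterated_twist_def)

text \<open>\<open>left_mul\<close>, \<open>mid_mul\<close> and \<open>right_mul\<close> are \<open>p \<otimes> w \<mapsto> p \<cdot> w\<close> on \<open>A \<otimes> (A \<otimes> B \<otimes> C)\<close>,
  the product of the two inner factors of \<open>(A \<otimes> B) \<otimes> (B \<otimes> C)\<close>, and
  \<open>w \<mapsto> w \<star> (b \<otimes> 1)\<close> with the product of \<open>B \<otimes> C\<close>.\<close>

definition left_mul :: "'a \<otimes> (('a \<otimes> 'b) \<otimes> 'c) \<Rightarrow> ('a \<otimes> 'b) \<otimes> 'c"
  where "left_mul = (((\<mu>A \<otimes>\<^sub>m id) \<circ> unassoc) \<otimes>\<^sub>m id) \<circ> unassoc"

definition mid_mul :: "('a \<otimes> 'b) \<otimes> ('b \<otimes> 'c) \<Rightarrow> ('a \<otimes> 'b) \<otimes> 'c"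
  where "mid_mul = (((id \<otimes>\<^sub>m \<mu>B) \<circ> assoc) \<otimes>\<^sub>m id) \<circ> unassoc"

definition right_mul :: "'b \<Rightarrow> ('a \<otimes> 'b) \<otimes> 'c \<Rightarrow> ('a \<otimes> 'b) \<otimes> 'c"
  where "right_mul b = unassoc \<circ> (id \<otimes>\<^sub>m (\<lambda>y. R2.m (y \<otimes> (b \<otimes> eC)))) \<circ> assoc"

lemma clinear_left_mul: "clinear left_mul" and clinear_mid_mul: "clinear mid_mul"
  unfolding left_mul_def mid_mul_def
  by (intro clinear_comp clinear_map_id clinear_id_map clinear_unassoc clinear_assoc
      R1.A.linear_mult R1.B.linear_mult)+

lemma clinear_mult_B: "clinear (\<lambda>y. R2.m (y \<otimes> (b \<otimes> eC)))"
  by (intro clinear_comp[unfolded o_def, OF R2.clinear_m] clinear_tensor_left)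

lemma clinear_right_mul: "clinear (right_mul b)"
  unfolding right_mul_def
  by (intro clinear_comp clinear_id_map clinear_unassoc clinear_assoc clinear_mult_B)

lemma left_mul_tensor: "left_mul (p \<otimes> (u \<otimes> h)) = R1.act p eB u \<otimes> h"
  by (simp add: left_mul_def unassoc_tensor map_id_tensor[OF clinear_comp] clinear_map_id
      clinear_unassoc R1.A.linear_mult R1.left_act)

lemma mid_mul_tensor: "mid_mul (u \<otimes> (k \<otimes> l)) = R1.act eA k u \<otimes> l"
  by (simp add: mid_mul_def unassoc_tensor map_id_tensor[OF clinear_comp] clinear_id_map
      clinear_assoc R1.B.linear_mult R1.right_act)

lemma assoc_unassoc: "assoc (unassoc w) = w"
proof (induction w rule: tensor_induct)
  case (pure a y)
  show ?case
    by (induction y rule: tensor_induct)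
      (simp_all add: unassoc_tensor assoc_tensor unassoc_add assoc_add tensor_add_right)
qed (simp add: unassoc_add assoc_add)

lemma right_mul_unassoc: "right_mul b (unassoc (p \<otimes> y)) = unassoc (p \<otimes> R2.m (y \<otimes> (b \<otimes> eC)))"
  by (simp add: right_mul_def assoc_unassoc id_map_tensor[OF clinear_mult_B])

lemma right_mul_tensor: "right_mul b ((p \<otimes> q) \<otimes> h) = unassoc (p \<otimes> R2.m ((q \<otimes> h) \<otimes> (b \<otimes> eC)))"
  by (simp add: right_mul_unassoc unassoc_tensor[symmetric])

lemmas lin_simps = R1.add_simps R2.add_simps R3.add_simps R1.map_simps R2.map_simps R3.map_simps
  clinear_add[OF clinear_left_mul] clinear_add[OF clinear_mid_mul] clinear_add[OF clinear_right_mul]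
  clinear_add[OF linear_T]
  clinear_add[OF clinear_mid_map[OF R2.linear_twist]]
  clinear_add[OF clinear_mid_map[OF R3.linear_twist]]

section \<open>The iterated twist and the product of A and B\<close>

lemma left_mul_unassoc: "left_mul (p \<otimes> unassoc (f \<otimes> s)) = unassoc (\<mu>A (p \<otimes> f) \<otimes> s)"
  by (induction s rule: tensor_induct)
    (simp_all add: left_mul_tensor unassoc_tensor R1.act_tensor R1.B.mult_unit_right lin_simps)

lemma mid_mul_pure: "mid_mul ((p \<otimes> q) \<otimes> y) = unassoc (p \<otimes> R2.act q eC y)"
  by (induction y rule: tensor_induct)
    (simp_all add: mid_mul_tensor unassoc_tensor R1.act_tensor R2.act_tensor R1.A.mult_unit_left
      R2.B.mult_unit_right lin_simps)

text \<open>Only the right factor \<open>b\<close> inside \<open>R2\<close> needs an argument, and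
  \<open>R2.R_mult_right\<close> moves it out; \<open>p\<close> multiplies the A-component, which
  \<open>R2\<close> leaves alone.\<close>

lemma T_mult_left_aux:
  "mid_map R2 (R3.act p eC u \<otimes> \<mu>B (y \<otimes> b)) = right_mul b (left_mul (p \<otimes> mid_map R2 (u \<otimes> y)))"
  by (induction u rule: tensor_induct)
    (simp_all add: R3.act_tensor R2.B.mult_unit_right mid_R2 left_mul_unassoc right_mul_unassoc
      R2.R_mult_right lin_simps)

text \<open>Informally, \<open>spread b (v \<otimes> w)\<close> is the threefold product v w b in
  the algebra on all three factors, with v in A and C, w in A and B, and b in B.\<close>

definition spread :: "'b \<Rightarrow> ('a \<otimes> 'c) \<otimes> ('a \<otimes> 'b) \<Rightarrow> ('a \<otimes> 'b) \<otimes> 'c"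
  where "spread b = right_mul b \<circ> left_mul \<circ> (id \<otimes>\<^sub>m T) \<circ> assoc"

lemma clinear_spread: "clinear (spread b)"
  unfolding spread_def
  by (intro clinear_comp clinear_right_mul clinear_left_mul clinear_id_map linear_T clinear_assoc)

lemma spread_tensor: "spread b ((p \<otimes> q) \<otimes> w) = right_mul b (left_mul (p \<otimes> T (q \<otimes> w)))"
  by (simp add: spread_def assoc_tensor id_map_tensor[OF linear_T])

text \<open>For \<open>w = x \<otimes> y\<close> the twisting law of \<open>R3\<close> splits the
  product of \<open>a\<close> and \<open>x\<close>, and that of \<open>R2\<close> the product of
  \<open>y\<close> and \<open>b\<close>.\<close>

lemma T_act: "T (c \<otimes> R1.act a b w) = spread b (R3 (c \<otimes> a) \<otimes> w)"
proof (induction w rule: tensor_induct)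
  case (pure x y)
  have "mid_map R2 (R3.m (v \<otimes> (x \<otimes> eC)) \<otimes> \<mu>B (y \<otimes> b)) = spread b (v \<otimes> (x \<otimes> y))" for v
    by (induction v rule: tensor_induct)
      (simp_all add: R3.m_tensor T_mult_left_aux spread_tensor T_tensor lin_simps
        clinear_add[OF clinear_spread])
  then show ?case
    by (simp add: R1.act_tensor T_tensor R3.R_mult_right)
qed (simp add: lin_simps clinear_add[OF clinear_spread])

text \<open>This collects the right side of the first twisting law for \<open>T\<close>, up to the
  initial \<open>T \<otimes>\<^sub>m id\<close>.\<close>

definition mult_T :: "(('a \<otimes> 'b) \<otimes> 'c) \<otimes> ('a \<otimes> 'b) \<Rightarrow> ('a \<otimes> 'b) \<otimes> 'c"
  where "mult_T = (R1.m \<otimes>\<^sub>m id) \<circ> unassoc \<circ> (id \<otimes>\<^sub>m T) \<circ> assoc"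

lemma clinear_mult_T: "clinear mult_T"
  unfolding mult_T_def
  by (intro clinear_comp clinear_map_id clinear_id_map linear_T clinear_assoc clinear_unassoc
      R1.clinear_m)

lemma mult_T_tensor: "mult_T ((u \<otimes> t) \<otimes> w) = (R1.m \<otimes>\<^sub>m id) (unassoc (u \<otimes> T (t \<otimes> w)))"
  by (simp add: mult_T_def assoc_tensor id_map_tensor[OF linear_T])

lemmas m_id_simps = map_id_tensor[OF R1.clinear_m] clinear_add[OF clinear_map_id[OF R1.clinear_m]]

lemma m_unassoc:
  "(R1.m \<otimes>\<^sub>m id) (unassoc ((p \<otimes> q) \<otimes> unassoc (g \<otimes> y))) = left_mul (p \<otimes> mid_mul (R1 (q \<otimes> g) \<otimes> y))"
  by (induction y rule: tensor_induct)
    (simp_all add: unassoc_tensor m_id_simps R1.m_tensor mid_mul_tensor left_mul_tensor R1.act_act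
      R1.A.mult_unit_right R1.B.mult_unit_right lin_simps del: id_apply)

lemma right_mul_left_mul:
  "right_mul b (left_mul (p \<otimes> (u \<otimes> h))) = left_mul (p \<otimes> mid_mul (u \<otimes> R2 (h \<otimes> b)))"
  by (induction u rule: tensor_induct)
    (simp_all add: left_mul_tensor right_mul_tensor R1.act_tensor mid_mul_pure left_mul_unassoc
      R1.B.mult_unit_right R2.m_tensor lin_simps)

text \<open>\<open>R1\<close> moves \<open>q\<close> to the right and \<open>R2\<close> moves
  \<open>b\<close> to the left at separate places; the results meet only in the product of B,
  through \<open>mid_mul\<close>, so the order of the two twists is immaterial.\<close>

lemma m_mid_R2:
  "(R1.m \<otimes>\<^sub>m id) (unassoc ((p \<otimes> q) \<otimes> mid_map R2 (u \<otimes> b)))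
    = right_mul b (left_mul (p \<otimes> (R1 \<otimes>\<^sub>m id) (unassoc (q \<otimes> u))))"
  by (induction u rule: tensor_induct)
    (simp_all add: mid_R2 m_unassoc unassoc_tensor right_mul_left_mul m_id_simps lin_simps del: id_apply)

lemma mult_T_unassoc:
  "mult_T (unassoc (p \<otimes> s) \<otimes> (a \<otimes> b))
    = right_mul b (left_mul (p \<otimes> (R1 \<otimes>\<^sub>m id) (mid_map R3 (s \<otimes> a))))"
  by (induction s rule: tensor_induct)
    (simp_all add: unassoc_tensor mult_T_tensor T_tensor m_mid_R2 mid_R3 lin_simps
      clinear_add[OF clinear_mult_T] del: id_apply)

text \<open>Compatibility enters the first twisting law here: \<open>mult_T_unassoc\<close> produces
  one side of \<open>hexagon\<close>, and the other side is the argument of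
  \<open>spread\<close>.\<close>

lemma mult_T_mid_R2:
  "mult_T (mid_map R2 (v \<otimes> b) \<otimes> (a' \<otimes> b')) = spread b' (v \<otimes> R1 (b \<otimes> a'))"
  by (induction v rule: tensor_induct)
    (simp_all add: mid_R2 mult_T_unassoc spread_tensor hexagon lin_simps
      clinear_add[OF clinear_mult_T] clinear_add[OF clinear_spread])

text \<open>On pure tensors \<open>T_act\<close> and \<open>mult_T_mid_R2\<close> bring both sides
  to the same \<open>spread\<close> expression.\<close>

lemma T_mult_left: "T (c \<otimes> R1.m (x \<otimes> y)) = mult_T (T (c \<otimes> x) \<otimes> y)"
proof (induction x rule: tensor_induct)
  case (pure a b)
  show ?case
    by (induction y rule: tensor_induct)
      (simp_all add: R1.m_tensor T_act T_tensor mult_T_mid_R2 lin_simps clinear_add[OF clinear_mult_T])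
qed (simp add: lin_simps clinear_add[OF clinear_mult_T])

section \<open>The iterated twist and the product of C\<close>

definition transfer :: "('a \<otimes> 'c) \<otimes> ('b \<otimes> 'c) \<Rightarrow> ('a \<otimes> 'b) \<otimes> 'c"
  where "transfer = (id \<otimes>\<^sub>m \<mu>C) \<circ> assoc \<circ> (mid_map R2 \<otimes>\<^sub>m id) \<circ> unassoc"

lemma clinear_transfer: "clinear transfer"
  unfolding transfer_def
  by (intro clinear_comp clinear_map_id clinear_id_map clinear_mid_map clinear_assoc clinear_unassoc
      R2.linear_twist R2.B.linear_mult)

lemma transfer_tensor: "transfer (v \<otimes> (s \<otimes> t)) = (id \<otimes>\<^sub>m \<mu>C) (assoc (mid_map R2 (v \<otimes> s) \<otimes> t))"
  by (simp add: transfer_def unassoc_tensor map_id_tensor[OF clinear_mid_map[OF R2.linear_twist]])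

lemma right_act_C: "(id \<otimes>\<^sub>m \<mu>C) (assoc (unassoc (p \<otimes> y) \<otimes> t)) = unassoc (p \<otimes> R2.act eB t y)"
  by (induction y rule: tensor_induct)
    (simp_all add: unassoc_tensor assoc_tensor R2.act_tensor R1.B.mult_unit_left lin_simps del: id_apply)

lemma transfer_pure: "transfer ((p \<otimes> q) \<otimes> s) = unassoc (p \<otimes> R2.m ((eB \<otimes> q) \<otimes> s))"
  by (induction s rule: tensor_induct)
    (simp_all add: transfer_tensor mid_R2 right_act_C R2.m_tensor lin_simps
      clinear_add[OF clinear_transfer] del: id_apply)

text \<open>The law \<open>R2.R_mult_left\<close> splits a product in C that moves past
  \<open>b\<close>: the right factor \<open>z\<close> passes first, and \<open>transfer\<close>
  brings the left one across.\<close>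

lemma mid_R2_act: "mid_map R2 (R3.act eA z v \<otimes> b) = transfer (v \<otimes> R2 (z \<otimes> b))"
  by (induction v rule: tensor_induct)
    (simp_all add: R3.act_tensor R1.A.mult_unit_left mid_R2 transfer_pure R2.R_mult_left lin_simps
      clinear_add[OF clinear_transfer])

definition T_mult :: "'c \<otimes> (('a \<otimes> 'b) \<otimes> 'c) \<Rightarrow> ('a \<otimes> 'b) \<otimes> 'c"
  where "T_mult = (id \<otimes>\<^sub>m \<mu>C) \<circ> assoc \<circ> (T \<otimes>\<^sub>m id) \<circ> unassoc"

lemma clinear_T_mult: "clinear T_mult"
  unfolding T_mult_def
  by (intro clinear_comp clinear_map_id clinear_id_map linear_T clinear_assoc clinear_unassoc
      R2.B.linear_mult)

lemma T_mult_unassoc: "T_mult (c \<otimes> unassoc (x \<otimes> s)) = transfer (R3 (c \<otimes> x) \<otimes> s)"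
  by (induction s rule: tensor_induct)
    (simp_all add: T_mult_def transfer_tensor unassoc_tensor map_id_tensor[OF linear_T] T_tensor
      lin_simps clinear_add[OF clinear_map_id[OF linear_T]] clinear_add[OF clinear_transfer]
      del: id_apply)

text \<open>\<open>T\<close> moves past \<open>a\<close> by \<open>R3\<close> and then past
  \<open>b\<close> by \<open>R2\<close>, so the product in C is split by the law of
  \<open>R3\<close> and then, through \<open>mid_R2_act\<close>, by that of
  \<open>R2\<close>.\<close>

lemma T_mult_right: "T (\<mu>C (c \<otimes> c') \<otimes> x) = T_mult (c \<otimes> T (c' \<otimes> x))"
proof (induction x rule: tensor_induct)
  case (pure a b)
  have "mid_map R2 (R3.m ((eA \<otimes> c) \<otimes> w) \<otimes> b) = T_mult (c \<otimes> mid_map R2 (w \<otimes> b))" for w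
    by (induction w rule: tensor_induct)
      (simp_all add: R3.m_tensor mid_R2_act mid_R2 T_mult_unassoc lin_simps
        clinear_add[OF clinear_T_mult])
  then show ?case
    by (simp add: T_tensor R3.R_mult_left)
qed (simp add: lin_simps clinear_add[OF clinear_T_mult])

lemma twisting_map_T: "twisting_map R1.m \<mu>C T"
proof (rule twisting_map.intro)
  show "T \<circ> (id \<otimes>\<^sub>m R1.m) \<circ> assoc =
      (R1.m \<otimes>\<^sub>m id) \<circ> unassoc \<circ> (id \<otimes>\<^sub>m T) \<circ> assoc \<circ> (T \<otimes>\<^sub>m id)"
    unfolding mult_T_def[symmetric]
  proof (rule additive_tensor_eqI)
    show "(T \<circ> (id \<otimes>\<^sub>m R1.m) \<circ> assoc) (z \<otimes> y) = (mult_T \<circ> (T \<otimes>\<^sub>m id)) (z \<otimes> y)" for z y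
      by (induction z rule: tensor_induct)
        (simp_all add: assoc_tensor id_map_tensor[OF R1.clinear_m] map_id_tensor[OF linear_T]
          T_mult_left lin_simps clinear_add[OF clinear_id_map[OF R1.clinear_m]]
          clinear_add[OF clinear_map_id[OF linear_T]]
          clinear_add[OF clinear_mult_T] del: id_apply)
  qed (use clinear_comp[OF clinear_comp[OF linear_T clinear_id_map[OF R1.clinear_m]] clinear_assoc]
      clinear_comp[OF clinear_mult_T clinear_map_id[OF linear_T]] in \<open>auto simp: clinear_iff\<close>)
  show "T \<circ> (\<mu>C \<otimes>\<^sub>m id) =
      (id \<otimes>\<^sub>m \<mu>C) \<circ> assoc \<circ> (T \<otimes>\<^sub>m id) \<circ> unassoc \<circ> (id \<otimes>\<^sub>m T) \<circ> assoc"
    unfolding T_mult_def[symmetric]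
  proof (rule additive_tensor_eqI)
    show "(T \<circ> (\<mu>C \<otimes>\<^sub>m id)) (z \<otimes> y) = (T_mult \<circ> (id \<otimes>\<^sub>m T) \<circ> assoc) (z \<otimes> y)" for z y
      by (induction z rule: tensor_induct)
        (simp_all add: assoc_tensor id_map_tensor[OF linear_T] T_mult_right lin_simps
          clinear_add[OF clinear_map_id[OF R2.B.linear_mult]]
          clinear_add[OF clinear_id_map[OF linear_T]] clinear_add[OF clinear_T_mult] del: id_apply)
  qed (use clinear_comp[OF linear_T clinear_map_id[OF R2.B.linear_mult]]
      clinear_comp[OF clinear_comp[OF clinear_T_mult clinear_id_map[OF linear_T]] clinear_assoc]
      in \<open>auto simp: clinear_iff\<close>)
qed (rule linear_T)

end

section \<open>The involution on three factors\<close>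

locale twisted_star_triple =
  S1: twisted_star_algebra \<mu>A eA jA \<mu>B eB jB R1 + S2: twisted_star_algebra \<mu>B eB jB \<mu>C eC jC R2 +
  S3: twisted_star_algebra \<mu>A eA jA \<mu>C eC jC R3 + twisted_triple \<mu>A eA \<mu>B eB \<mu>C eC R1 R2 R3
  for \<mu>A :: "'a::complex_vector \<otimes> 'a \<Rightarrow> 'a" and eA jA
    and \<mu>B :: "'b::complex_vector \<otimes> 'b \<Rightarrow> 'b" and eB jB
    and \<mu>C :: "'c::complex_vector \<otimes> 'c \<Rightarrow> 'c" and eC jC
    and R1 :: "'b \<otimes> 'a \<Rightarrow> 'a \<otimes> 'b"
    and R2 :: "'c \<otimes> 'b \<Rightarrow> 'b \<otimes> 'c"
    and R3 :: "'c \<otimes> 'a \<Rightarrow> 'a \<otimes> 'c"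
begin

abbreviation J where "J \<equiv> twisted_star T S1.j jC"

lemma antilinear_J: "antilinear J"
  unfolding twisted_star_def[of T]
  by (intro antilinear_comp_clinear antilinear_comp tensor_map_tensor_antilinear linear_T
      S1.antilinear_j S2.B.antilinear_star clinear_flip)

lemma J_tensor: "J (u \<otimes> c) = T (jC c \<otimes> S1.j u)"
  unfolding twisted_star_def[of T]
  by (simp add: flip_tensor tensor_map_tensor_antilinear[OF S2.B.antilinear_star S1.antilinear_j])

lemmas star_simps = lin_simps antilinear_add[OF antilinear_J] antilinear_add[OF S1.antilinear_j]
  antilinear_add[OF S2.antilinear_j] antilinear_add[OF S3.antilinear_j]

text \<open>For pure \<open>s\<close> the inner \<open>S1.j\<close> puts an \<open>R1\<close> inside
  \<open>T\<close>; \<open>hexagon\<close> exchanges it for an \<open>R2\<close>, which together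
  with \<open>jB\<close> and \<open>jC\<close> forms \<open>S2.j s\<close>.\<close>

lemma J_unassoc: "J (unassoc (p \<otimes> s)) = (R1 \<otimes>\<^sub>m id) (mid_map R3 (S2.j s \<otimes> jA p))"
  by (induction s rule: tensor_induct)
    (simp_all add: unassoc_tensor J_tensor S1.j_tensor S2.j_tensor hexagon star_simps del: id_apply)

text \<open>By \<open>J_unassoc\<close> the twist \<open>R2\<close> meets \<open>S2.j\<close>, and
  \<open>S2.j_R\<close> cancels it; the leftover \<open>R3\<close> completes
  \<open>S3.j v\<close>.\<close>

lemma J_mid_R2: "J (mid_map R2 (v \<otimes> y)) = (R1 \<otimes>\<^sub>m id) (unassoc (jB y \<otimes> S3.j v))"
  by (induction v rule: tensor_induct)
    (simp_all add: mid_R2 J_unassoc S2.j_R S3.j_tensor mid_R3 star_simps del: id_apply)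

text \<open>The counterpart of \<open>j_R\<close> for \<open>T\<close>: \<open>J_mid_R2\<close>
  removes \<open>R2\<close>, then \<open>S3.j_R\<close> removes \<open>R3\<close>, and the surviving
  \<open>R1\<close> forms \<open>S1.j w\<close>.\<close>

lemma J_T: "J (T (c \<otimes> w)) = S1.j w \<otimes> jC c"
  by (induction w rule: tensor_induct)
    (simp_all add: T_tensor J_mid_R2 S3.j_R S1.j_tensor unassoc_tensor star_simps)

lemma J_J: "J (J x) = x"
  by (induction x rule: tensor_induct)
    (simp_all add: J_tensor J_T S1.j_j S3.jB_jB star_simps)

text \<open>The three flips reverse the order of the factors, and \<open>hexagon\<close> rewrites
  the three twists as \<open>T\<close> after \<open>R1\<close>. Both maps are additive, so agreement
  on pure tensors suffices.\<close>

lemma J_eq: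
  "(R1 \<otimes>\<^sub>m id) \<circ> mid_map R3 \<circ> (R2 \<otimes>\<^sub>m id) \<circ> (jC \<otimes>\<^sub>m jB \<otimes>\<^sub>m jA)
    \<circ> mid_map flip \<circ> (flip \<otimes>\<^sub>m id) \<circ> mid_map flip = J"
proof -
  define K where "K = (R1 \<otimes>\<^sub>m id) \<circ> mid_map R3 \<circ> (R2 \<otimes>\<^sub>m id) \<circ> (jC \<otimes>\<^sub>m jB \<otimes>\<^sub>m jA)
    \<circ> mid_map flip \<circ> (flip \<otimes>\<^sub>m id) \<circ> mid_map flip"
  note anti = S2.B.antilinear_star S1.B.antilinear_star S1.A.antilinear_star
  note CB = tensor_map_tensor_antilinear[OF anti(1) anti(2)]
  note CBA = tensor_map_tensor_antilinear[OF CB(2) anti(3)]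
  have K: "antilinear K"
    unfolding K_def
    \<comment> \<open>The first three rules peel off the linear flips; the fourth separates the
      antilinear tensor of involutions from the linear twists.\<close>
    by (rule antilinear_comp_clinear, rule antilinear_comp_clinear, rule antilinear_comp_clinear,
        rule antilinear_comp)
      (intro clinear_comp CBA clinear_map_id clinear_mid_map clinear_flip
        S1.linear_twist S2.linear_twist S3.linear_twist)+
  have pure: "K (a \<otimes> b \<otimes> c) = J (a \<otimes> b \<otimes> c)" for a b c
    by (simp add: K_def mid_map_tensor[OF clinear_flip] flip_tensor unassoc_tensor
        map_id_tensor[OF clinear_flip] CB CBA S2.map_simps hexagon J_tensor S1.j_tensor)
  show ?thesis
    unfolding K_def[symmetric]
  proof (rule additive_tensor_eqI)
    show "K (x \<otimes> c) = J (x \<otimes> c)" for x c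
      by (induction x rule: tensor_induct)
        (simp_all add: pure tensor_add_left antilinear_add[OF K] antilinear_add[OF antilinear_J])
  qed (use K antilinear_J in \<open>simp_all add: antilinear_def\<close>)
qed

lemma star_algebra_triple:
  "star_algebra (iterated_mult \<mu>A \<mu>B \<mu>C R1 R2 R3) (eA \<otimes> eB \<otimes> eC)
    ((R1 \<otimes>\<^sub>m id) \<circ> mid_map R3 \<circ> (R2 \<otimes>\<^sub>m id) \<circ> (jC \<otimes>\<^sub>m jB \<otimes>\<^sub>m jA)
      \<circ> mid_map flip \<circ> (flip \<otimes>\<^sub>m id) \<circ> mid_map flip)"
proof -
  interpret AB: star_algebra S1.m "eA \<otimes> eB" S1.j by (rule S1.star_algebra_m)
  interpret T: twisting_map S1.m \<mu>C T by (rule twisting_map_T)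
  interpret ABC: twisted_star_algebra S1.m "eA \<otimes> eB" S1.j \<mu>C eC jC T
    by unfold_locales (simp add: fun_eq_iff J_J)
  show ?thesis
    unfolding J_eq iterated_mult_def by (rule ABC.star_algebra_m)
qed

end

theorem theorem2p19:
  fixes \<mu>A :: "'a::complex_vector \<otimes> 'a \<Rightarrow> 'a" and eA :: 'a and jA :: "'a \<Rightarrow> 'a"
    and \<mu>B :: "'b::complex_vector \<otimes> 'b \<Rightarrow> 'b" and eB :: 'b and jB :: "'b \<Rightarrow> 'b"
    and \<mu>C :: "'c::complex_vector \<otimes> 'c \<Rightarrow> 'c" and eC :: 'c and jC :: "'c \<Rightarrow> 'c"
    and R1 :: "'b \<otimes> 'a \<Rightarrow> 'a \<otimes> 'b"
    and R2 :: "'c \<otimes> 'b \<Rightarrow> 'b \<otimes> 'c"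
    and R3 :: "'c \<otimes> 'a \<Rightarrow> 'a \<otimes> 'c"
  assumes "star_algebra \<mu>A eA jA" and "star_algebra \<mu>B eB jB" and "star_algebra \<mu>C eC jC"
    and "twisting_map \<mu>A \<mu>B R1" and "twisting_map \<mu>B \<mu>C R2" and "twisting_map \<mu>A \<mu>C R3"
    and "compatible R1 R2 R3"
    and "(R1 \<circ> (jB \<otimes>\<^sub>m jA) \<circ> flip) \<circ> (R1 \<circ> (jB \<otimes>\<^sub>m jA) \<circ> flip) = id"
    and "(R2 \<circ> (jC \<otimes>\<^sub>m jB) \<circ> flip) \<circ> (R2 \<circ> (jC \<otimes>\<^sub>m jB) \<circ> flip) = id"
    and "(R3 \<circ> (jC \<otimes>\<^sub>m jA) \<circ> flip) \<circ> (R3 \<circ> (jC \<otimes>\<^sub>m jA) \<circ> flip) = id"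
  shows "star_algebra (iterated_mult \<mu>A \<mu>B \<mu>C R1 R2 R3) (eA \<otimes> eB \<otimes> eC)
    ((R1 \<otimes>\<^sub>m id) \<circ> mid_map R3 \<circ> (R2 \<otimes>\<^sub>m id) \<circ> (jC \<otimes>\<^sub>m jB \<otimes>\<^sub>m jA)
      \<circ> mid_map flip \<circ> (flip \<otimes>\<^sub>m id) \<circ> mid_map flip)"
proof -
  interpret A: star_algebra \<mu>A eA jA by (rule assms)
  interpret B: star_algebra \<mu>B eB jB by (rule assms)
  interpret C: star_algebra \<mu>C eC jC by (rule assms)
  interpret R1: twisting_map \<mu>A \<mu>B R1 by (rule assms)
  interpret R2: twisting_map \<mu>B \<mu>C R2 by (rule assms)
  interpret R3: twisting_map \<mu>A \<mu>C R3 by (rule assms)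
  interpret twisted_star_triple \<mu>A eA jA \<mu>B eB jB \<mu>C eC jC R1 R2 R3
    by unfold_locales (use assms in \<open>simp_all add: twisted_star_def\<close>)
  show ?thesis by (rule star_algebra_triple)
qed

end
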